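(* Let $E$ be a $\sigma$-lattice effect algebra and let $a,b\in E$. Then $q_a\preceq_s q_b$ if and only if $a\le b$. In addition, for every $x\in\mathcal{EO}(E)$ we have $q_0\preceq_s x\preceq_s q_1$.
   Context: An effect algebra is a partial algebra $(E;+,0,1)$ with a partially defined binary operation $+$ such that for all $a,b,c\in E$: (i) $a+b$ is defined iff $b+a$ is, and then $a+b=b+a$; (ii) $a+b$ and $(a+b)+c$ are defined iff $b+c$ and $a+(b+c)$ are defined, and then $(a+b)+c=a+(b+c)$; (iii) for each $a$ there is a unique $a'\in E$ with $a+a'=1$; (iv) if $a+1$ is defined, then $a=0$. The partial order is $a\le b$ iff $a+c=b$ for some $c\in E$. $E$ is a $\sigma$-lattice effect algebra if $(E,\le)$ is a lattice in which all countable suprema and infima exist. Let $\mathcal B(\mathbb R)$ be the Borel $\sigma$-algebra of $\mathbb R$. An observable on $E$ is a map $x:\mathcal B(\mathbb R)\to E$ such that (i) $x(\mathbb R)=1$; (ii) if $B\cap C=\emptyset$, then $x(B)+x(C)$ is defined and $x(B\cup C)=x(B)+x(C)$; (iii) if $B_i\subseteq B_{i+1}$ for all $i$ and $B=\bigcup_i B_i$, then $x(B)=\bigvee_i x(B_i)$. The spectrum $\sigma(x)$ is the least closed set $K\subseteq\mathbb R$ with $x(K)=1$. $\mathcal{EO}(E)$ is the set of observables $x$ on $E$ with $\sigma(x)\subseteq[0,1]$. The Olson order on observables is: $x\preceq_s y$ iff $y((-\infty,t))\le x((-\infty,t))$ for every $t\in\mathbb R$. For $a\in E$, the question observable $q_a$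 is the observable with $q_a(\{0\})=a'$, $q_a(\{1\})=a$; i.e. $q_a(B)$ is $1$, $a$, $a'$ or $0$ according as $B$ contains both $0$ and $1$, only $1$, only $0$, or neither. *)

theory Defs
  imports "HOL-Analysis.Analysis" "HOL-Algebra.Lattice"
begin

text \<open>
  The partial sum is option-valued, with \<open>None\<close> for ``undefined''. Equations between option
  values therefore say that one side is defined iff the other is, and that they then agree.
\<close>

record 'a effect_structure = "'a partial_object" +
  psum :: "'a \<Rightarrow> 'a \<Rightarrow> 'a option"
  ezero :: 'a
  eunit :: 'a

locale effect_algebra =
  fixes E :: "('a, 'm) effect_structure_scheme"
  assumes ezero_closed: "ezero E \<in> carrier E"
    and eunit_closed: "eunit E \<in> carrier E"
    and psum_closed:
      "\<lbrakk>a \<in> carrier E; b \<in> carrier E; psum E a b = Some c\<rbrakk> \<Longrightarrow> c \<in> carrier E"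
    and psum_commute:
      "\<lbrakk>a \<in> carrier E; b \<in> carrier E\<rbrakk> \<Longrightarrow> psum E a b = psum E b a"
    and psum_assoc:
      "\<lbrakk>a \<in> carrier E; b \<in> carrier E; c \<in> carrier E\<rbrakk> \<Longrightarrow>
        Option.bind (psum E a b) (\<lambda>d. psum E d c) = Option.bind (psum E b c) (psum E a)"
    and ex1_complement:
      "a \<in> carrier E \<Longrightarrow> \<exists>!c. c \<in> carrier E \<and> psum E a c = Some (eunit E)"
    and zero_if_psum_unit:
      "\<lbrakk>a \<in> carrier E; psum E a (eunit E) \<noteq> None\<rbrakk> \<Longrightarrow> a = ezero E"

definition ecompl :: "('a, 'm) effect_structure_scheme \<Rightarrow> 'a \<Rightarrow> 'a" where
  "ecompl E a = (THE c. c \<in> carrier E \<and> psum E a c = Some (eunit E))"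

definition ele :: "('a, 'm) effect_structure_scheme \<Rightarrow> 'a \<Rightarrow> 'a \<Rightarrow> bool" where
  "ele E a b \<longleftrightarrow> (\<exists>c\<in>carrier E. psum E a c = Some b)"

definition eorder :: "('a, 'm) effect_structure_scheme \<Rightarrow> 'a gorder" where
  "eorder E = \<lparr>carrier = carrier E, eq = (=), le = ele E\<rparr>"

locale sigma_lattice_effect_algebra = effect_algebra E
  for E :: "('a, 'm) effect_structure_scheme" +
  assumes lattice_eorder: "Lattice.lattice (eorder E)"
    and countable_sup:
      "\<lbrakk>A \<subseteq> carrier E; countable A\<rbrakk> \<Longrightarrow> \<exists>s. least (eorder E) s (Upper (eorder E) A)"
    and countable_inf:
      "\<lbrakk>A \<subseteq> carrier E; countable A\<rbrakk> \<Longrightarrow> \<exists>i. greatest (eorder E) i (Lower (eorder E) A)"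

text \<open>
  Observables are total functions on \<^typ>\<open>real set\<close> of which only the values on Borel sets matter.
\<close>

definition observable :: "('a, 'm) effect_structure_scheme \<Rightarrow> (real set \<Rightarrow> 'a) \<Rightarrow> bool" where
  "observable E x \<longleftrightarrow>
     (\<forall>B\<in>sets borel. x B \<in> carrier E) \<and>
     x UNIV = eunit E \<and>
     (\<forall>B\<in>sets borel. \<forall>C\<in>sets borel. B \<inter> C = {} \<longrightarrow> psum E (x B) (x C) = Some (x (B \<union> C))) \<and>
     (\<forall>B :: nat \<Rightarrow> real set. (\<forall>i. B i \<in> sets borel) \<longrightarrow> (\<forall>i. B i \<subseteq> B (Suc i)) \<longrightarrow>
        least (eorder E) (x (\<Union>i. B i)) (Upper (eorder E) (range (\<lambda>i. x (B i)))))"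

text \<open>
  For every observable the least such closed set exists, because \<^typ>\<open>real\<close> is second countable.
\<close>

definition spectrum :: "('a, 'm) effect_structure_scheme \<Rightarrow> (real set \<Rightarrow> 'a) \<Rightarrow> real set" where
  "spectrum E x = (LEAST K. closed K \<and> x K = eunit E)"

definition EO :: "('a, 'm) effect_structure_scheme \<Rightarrow> (real set \<Rightarrow> 'a) set" where
  "EO E = {x. observable E x \<and> spectrum E x \<subseteq> {0..1}}"

text \<open>
  The Olson order is a relation on observables, so it contains no pairs of other functions.
\<close>

definition olson_le ::
  "('a, 'm) effect_structure_scheme \<Rightarrow> (real set \<Rightarrow> 'a) \<Rightarrow> (real set \<Rightarrow> 'a) \<Rightarrow> bool" where
  "olson_le E x y \<longleftrightarrow> observable E x \<and> observable E y \<and> (\<forall>t. ele E (y {..<t}) (x {..<t}))"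

definition question :: "('a, 'm) effect_structure_scheme \<Rightarrow> 'a \<Rightarrow> real set \<Rightarrow> 'a" where
  "question E a B =
     (if 0 \<in> B \<and> 1 \<in> B then eunit E
      else if 1 \<in> B then a
      else if 0 \<in> B then ecompl E a
      else ezero E)"

end

theory Submission
  imports Defs
begin

text \<open>
  The half-line \<open>(-\<infinity>, t)\<close> has \<open>q\<^sub>a\<close>-value \<open>0\<close>, \<open>a'\<close> or \<open>1\<close> according as \<open>t \<le> 0\<close>,
  \<open>0 < t \<le> 1\<close> or \<open>1 < t\<close>. The Olson comparison of \<open>q\<^sub>a\<close> with \<open>q\<^sub>b\<close> therefore reduces to the single
  inequality \<open>b' \<le> a'\<close>, and the complement reverses the order (\<open>ele_ecompl_iff\<close>). Since the Olson
  order relates observables only, \<open>q\<^sub>a\<close> also has to be recognised as one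
  (\<open>observable_question\<close>). Its continuity is immediate: along an increasing sequence of sets,
  membership of the two points \<open>0\<close> and \<open>1\<close> is eventually constant.

  For the bounds, let \<open>x\<close> have its spectrum in \<open>[0,1]\<close>. The half-line values of \<open>q\<^sub>0\<close> and \<open>q\<^sub>1\<close>
  are \<open>0\<close> or \<open>1\<close>, with jumps at \<open>0\<close> and at \<open>1\<close>, so what has to be shown is that \<open>x\<close> vanishes on
  \<open>(-\<infinity>, t)\<close> for \<open>t \<le> 0\<close> and equals \<open>1\<close> there for \<open>t > 1\<close>. By monotonicity both follow from
  \<open>x([0,1]) = 1\<close>, that is, from the fact that the spectrum carries the whole observable
  (\<open>spectrum_carries_observable\<close>). This is where second countability is used: the union
  of all open null sets is a countable union of them, hence null, and its complement is the least
  closed set of value \<open>1\<close>.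
\<close>

section \<open>Zero, unit and order in an effect algebra\<close>

context effect_algebra
begin

lemma
  assumes "a \<in> carrier E"
  shows ecompl_closed: "ecompl E a \<in> carrier E"
    and psum_ecompl: "psum E a (ecompl E a) = Some (eunit E)"
  using theI'[OF ex1_complement[OF assms]] unfolding ecompl_def by blast+

lemma ecompl_unique:
  assumes "a \<in> carrier E" "c \<in> carrier E" "psum E a c = Some (eunit E)"
  shows "ecompl E a = c"
  using ex1_complement[OF assms(1)] assms ecompl_closed psum_ecompl by blast

lemma ecompl_ecompl: "a \<in> carrier E \<Longrightarrow> ecompl E (ecompl E a) = a"
  by (metis ecompl_unique ecompl_closed psum_ecompl psum_commute)

text \<open>The complement of \<open>1\<close> can be added to \<open>1\<close>, so the last axiom forces it to be \<open>0\<close>.\<close>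

lemma ecompl_eunit: "ecompl E (eunit E) = ezero E"
  by (metis ecompl_closed eunit_closed option.distinct(1) psum_commute psum_ecompl
      zero_if_psum_unit)

lemma ecompl_ezero: "ecompl E (ezero E) = eunit E"
  by (metis ecompl_ecompl ecompl_eunit eunit_closed)

text \<open>
  Associativity turns \<open>(a' + a) + 0 = 1 + 0 = 1\<close> into \<open>a' + (a + 0) = 1\<close>, so that \<open>a + 0\<close> is
  the complement of \<open>a'\<close>, which is \<open>a\<close>.
\<close>

lemma psum_ezero:
  assumes a: "a \<in> carrier E"
  shows "psum E a (ezero E) = Some a"
proof -
  have c: "ecompl E a \<in> carrier E" and ca: "psum E (ecompl E a) a = Some (eunit E)"
    using a ecompl_closed psum_ecompl psum_commute by metis+
  have "psum E (eunit E) (ezero E) = Some (eunit E)"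
    using psum_ecompl[OF eunit_closed] by (simp add: ecompl_eunit)
  then have "Option.bind (psum E a (ezero E)) (psum E (ecompl E a)) = Some (eunit E)"
    using psum_assoc[OF c a ezero_closed] ca by simp
  then obtain d where d: "psum E a (ezero E) = Some d" "psum E (ecompl E a) d = Some (eunit E)"
    by (auto simp: bind_eq_Some_conv)
  then show ?thesis
    using ecompl_unique[OF c psum_closed[OF a ezero_closed d(1)] d(2)] ecompl_ecompl[OF a] by simp
qed

lemma ezero_psum: "a \<in> carrier E \<Longrightarrow> psum E (ezero E) a = Some a"
  using psum_ezero psum_commute ezero_closed by metis

lemma ele_refl: "a \<in> carrier E \<Longrightarrow> ele E a a"
  unfolding ele_def using psum_ezero ezero_closed by blast

lemma ezero_ele: "a \<in> carrier E \<Longrightarrow> ele E (ezero E) a"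
  unfolding ele_def using ezero_psum by blast

lemma ele_eunit: "a \<in> carrier E \<Longrightarrow> ele E a (eunit E)"
  unfolding ele_def using psum_ecompl ecompl_closed by blast

lemma eunit_ele_imp_eq:
  assumes "ele E (eunit E) a"
  shows "a = eunit E"
proof -
  obtain c where c: "c \<in> carrier E" "psum E (eunit E) c = Some a"
    using assms unfolding ele_def by blast
  then have "c = ezero E"
    using zero_if_psum_unit psum_commute eunit_closed by (metis option.distinct(1))
  then show ?thesis
    using c psum_ezero[OF eunit_closed] by simp
qed

text \<open>
  If \<open>a + c = 0\<close>, then \<open>(a + c) + 1\<close> is defined, hence so is \<open>c + 1\<close>. The last axiom gives
  \<open>c = 0\<close>, and then \<open>a = a + 0 = 0\<close>.
\<close>

lemma ele_ezero_imp_eq: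
  assumes a: "a \<in> carrier E" and "ele E a (ezero E)"
  shows "a = ezero E"
proof -
  obtain c where c: "c \<in> carrier E" "psum E a c = Some (ezero E)"
    using assms unfolding ele_def by blast
  have "Option.bind (psum E c (eunit E)) (psum E a) = Some (eunit E)"
    using psum_assoc[OF a c(1) eunit_closed] c ezero_psum[OF eunit_closed] by simp
  then have "psum E c (eunit E) \<noteq> None"
    by (auto simp: bind_eq_Some_conv)
  then have "c = ezero E"
    using zero_if_psum_unit c by blast
  then show ?thesis
    using c psum_ezero[OF a] by simp
qed

text \<open>
  If \<open>a + c = b\<close>, then \<open>a + (c + b') = (a + c) + b' = 1\<close>, so \<open>c\<close> witnesses \<open>b' \<le> a'\<close> as well.
\<close>

lemma ecompl_antimono:
  assumes a: "a \<in> carrier E" and b: "b \<in> carrier E" and "ele E a b"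
  shows "ele E (ecompl E b) (ecompl E a)"
proof -
  obtain c where c: "c \<in> carrier E" "psum E a c = Some b"
    using assms unfolding ele_def by blast
  have b': "ecompl E b \<in> carrier E"
    using ecompl_closed[OF b] .
  have "Option.bind (psum E c (ecompl E b)) (psum E a) = Some (eunit E)"
    using psum_assoc[OF a c(1) b'] c psum_ecompl[OF b] by simp
  then obtain d where d: "psum E c (ecompl E b) = Some d" "psum E a d = Some (eunit E)"
    by (auto simp: bind_eq_Some_conv)
  then have "ecompl E a = d"
    using ecompl_unique[OF a] psum_closed[OF c(1) b'] by blast
  then show ?thesis
    using d c b' psum_commute unfolding ele_def by metis
qed

lemma ele_ecompl_iff:
  assumes "a \<in> carrier E" "b \<in> carrier E"
  shows "ele E (ecompl E b) (ecompl E a) \<longleftrightarrow> ele E a b"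
  using ecompl_antimono[of a b] ecompl_antimono[of "ecompl E b" "ecompl E a"]
    assms ecompl_closed ecompl_ecompl by auto

lemma least_Upper_eorder_iff:
  assumes "S \<subseteq> carrier E"
  shows "least (eorder E) s (Upper (eorder E) S) \<longleftrightarrow>
    s \<in> carrier E \<and> (\<forall>b\<in>S. ele E b s) \<and>
    (\<forall>u\<in>carrier E. (\<forall>b\<in>S. ele E b u) \<longrightarrow> ele E s u)"
proof -
  have "Upper (eorder E) S = {u \<in> carrier E. \<forall>b\<in>S. ele E b u}"
    using assms unfolding Upper_def eorder_def by auto
  then show ?thesis
    unfolding least_def by (auto simp: eorder_def)
qed

section \<open>Question observables\<close>

lemma question_closed: "a \<in> carrier E \<Longrightarrow> question E a B \<in> carrier E"
  unfolding question_def by (simp add: eunit_closed ezero_closed ecompl_closed)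

lemma question_psum:
  assumes a: "a \<in> carrier E" and disj: "B \<inter> C = {}"
  shows "psum E (question E a B) (question E a C) = Some (question E a (B \<union> C))"
proof -
  have "psum E (ecompl E a) a = Some (eunit E)"
    using a ecompl_closed psum_ecompl psum_commute by metis
  moreover have "\<not> (0 \<in> B \<and> 0 \<in> C)" "\<not> (1 \<in> B \<and> 1 \<in> C)"
    using disj by auto
  ultimately show ?thesis
    using a unfolding question_def
    by (auto simp: psum_ezero ezero_psum psum_ecompl ecompl_closed eunit_closed ezero_closed)
qed

lemma question_mono:
  assumes "a \<in> carrier E" "B \<subseteq> C"
  shows "ele E (question E a B) (question E a C)"
  using question_psum[OF assms(1), of B "C - B"] question_closed[OF assms(1)] assms(2)
  unfolding ele_def by (auto simp: Un_absorb1)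

text \<open>
  A question observable sees only whether \<open>0\<close> and \<open>1\<close> belong to a set, so along an increasing
  sequence its value at the union is already attained by some member.
\<close>

lemma observable_question:
  assumes a: "a \<in> carrier E"
  shows "observable E (question E a)"
proof -
  have "least (eorder E) (question E a (\<Union>i. B i))
          (Upper (eorder E) (range (\<lambda>i. question E a (B i))))"
    if inc: "\<And>i. B i \<subseteq> B (Suc i)" for B :: "nat \<Rightarrow> real set"
  proof -
    have mono: "B i \<subseteq> B j" if "i \<le> j" for i j
      using lift_Suc_mono_le[of B] inc that by blast
    have settle: "\<exists>n. \<forall>m\<ge>n. r \<in> B m \<longleftrightarrow> r \<in> (\<Union>i. B i)" for r
    proof (cases "r \<in> (\<Union>i. B i)")
      case True
      then obtain n where "r \<in> B n"
        by blast
      then have "\<forall>m\<ge>n. r \<in> B m"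
        using mono by blast
      then show ?thesis
        using True by blast
    qed blast
    obtain m n where "\<forall>k\<ge>m. 0 \<in> B k \<longleftrightarrow> 0 \<in> (\<Union>i. B i)" "\<forall>k\<ge>n. 1 \<in> B k \<longleftrightarrow> 1 \<in> (\<Union>i. B i)"
      using settle by meson
    then have "0 \<in> B (max m n) \<longleftrightarrow> 0 \<in> (\<Union>i. B i)" "1 \<in> B (max m n) \<longleftrightarrow> 1 \<in> (\<Union>i. B i)"
      by simp_all
    then have "question E a (B (max m n)) = question E a (\<Union>i. B i)"
      unfolding question_def by presburger
    moreover have "ele E (question E a (B i)) (question E a (\<Union>i. B i))" for i
      by (rule question_mono[OF a]) blast
    moreover have "range (\<lambda>i. question E a (B i)) \<subseteq> carrier E"
      using question_closed[OF a] by blast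
    ultimately show ?thesis
      by (subst least_Upper_eorder_iff) (auto simp: question_closed[OF a], metis)
  qed
  moreover have "question E a UNIV = eunit E"
    by (simp add: question_def)
  ultimately show ?thesis
    unfolding observable_def using question_closed[OF a] question_psum[OF a] by blast
qed

lemma question_lessThan:
  "question E a {..<t} =
    (if t \<le> 0 then ezero E else if t \<le> 1 then ecompl E a else eunit E)"
  by (simp add: question_def)

text \<open>Only parameters \<open>t\<close> with \<open>0 < t \<le> 1\<close> impose a condition on \<open>a\<close> and \<open>b\<close>; \<open>t = 1\<close> is one.\<close>

lemma olson_le_question_iff:
  assumes "a \<in> carrier E" "b \<in> carrier E"
  shows "olson_le E (question E a) (question E b) \<longleftrightarrow> ele E a b"
proof -
  have "(\<forall>t. ele E (question E b {..<t}) (question E a {..<t})) \<longleftrightarrow>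
      ele E (ecompl E b) (ecompl E a)" (is "?L \<longleftrightarrow> ?R")
  proof
    assume ?L
    then show ?R
      by (auto simp: question_lessThan dest: spec[of _ 1])
  next
    assume ?R
    then show ?L
      by (simp add: question_lessThan ele_refl ezero_closed eunit_closed)
  qed
  then show ?thesis
    unfolding olson_le_def using assms observable_question ele_ecompl_iff by simp
qed

section \<open>The spectrum of an observable\<close>

context
  fixes x :: "real set \<Rightarrow> 'a"
  assumes x: "observable E x"
begin

lemma observable_closed: "B \<in> sets borel \<Longrightarrow> x B \<in> carrier E"
  using x unfolding observable_def by blast

lemma observable_UNIV: "x UNIV = eunit E"
  using x unfolding observable_def by blast

lemma observable_psum:
  "\<lbrakk>B \<in> sets borel; C \<in> sets borel; B \<inter> C = {}\<rbrakk> \<Longrightarrow> psum E (x B) (x C) = Some (x (B \<union> C))"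
  using x unfolding observable_def by blast

lemma observable_mono:
  assumes "B \<in> sets borel" "C \<in> sets borel" "B \<subseteq> C"
  shows "ele E (x B) (x C)"
proof -
  have "psum E (x B) (x (C - B)) = Some (x C)"
    using observable_psum[of B "C - B"] assms by (auto simp: Un_absorb1)
  then show ?thesis
    using observable_closed[of "C - B"] assms unfolding ele_def by blast
qed

lemma observable_null_subset:
  assumes "B \<in> sets borel" "C \<in> sets borel" "B \<subseteq> C" "x C = ezero E"
  shows "x B = ezero E"
  using observable_mono[OF assms(1-3)] observable_closed[OF assms(1)] assms(4) ele_ezero_imp_eq
  by simp

lemma observable_Compl:
  assumes "B \<in> sets borel"
  shows "x (- B) = ecompl E (x B)"
proof -
  have "- B \<in> sets borel"
    using assms by (simp add: borel_comp)
  then show ?thesis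
    using ecompl_unique[of "x B" "x (- B)"] observable_psum[of B "- B"] observable_closed assms
    by (simp add: observable_UNIV)
qed

lemma observable_eq_eunit_iff:
  assumes "B \<in> sets borel"
  shows "x B = eunit E \<longleftrightarrow> x (- B) = ezero E"
  using observable_Compl[OF assms] ecompl_ecompl[OF observable_closed[OF assms]]
    ecompl_eunit ecompl_ezero by metis

lemma observable_empty: "x {} = ezero E"
  using observable_eq_eunit_iff[of UNIV] observable_UNIV by simp

lemma observable_null_Un:
  assumes "B \<in> sets borel" "C \<in> sets borel" "x B = ezero E" "x C = ezero E"
  shows "x (B \<union> C) = ezero E"
proof -
  have "x (C - B) = ezero E"
    using observable_null_subset[of "C - B" C] assms by auto
  then show ?thesis
    using observable_psum[of B "C - B"] assms psum_ezero[OF ezero_closed] by auto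
qed

text \<open>
  The finite partial unions are null and increase to the union, whose value is therefore the
  supremum of zeros.
\<close>

lemma observable_null_UN:
  fixes U :: "nat \<Rightarrow> real set"
  assumes U: "\<And>i. U i \<in> sets borel" "\<And>i. x (U i) = ezero E"
  shows "x (\<Union>i. U i) = ezero E"
proof -
  define V where "V n = (\<Union>i<n. U i)" for n
  have V_borel: "V n \<in> sets borel" for n
    unfolding V_def using U(1) by auto
  have V_null: "x (V n) = ezero E" for n
  proof (induction n)
    case 0
    show ?case by (simp add: V_def observable_empty)
  next
    case (Suc n)
    have "V (Suc n) = V n \<union> U n"
      unfolding V_def by (auto simp: less_Suc_eq)
    then show ?case
      using observable_null_Un[OF V_borel U(1) Suc U(2)] by simp
  qed
  have "\<forall>n. V n \<subseteq> V (Suc n)"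
    unfolding V_def by (auto intro: less_SucI)
  then have "least (eorder E) (x (\<Union>n. V n)) (Upper (eorder E) (range (\<lambda>n. x (V n))))"
    using x V_borel unfolding observable_def by blast
  moreover have "range (\<lambda>n. x (V n)) \<subseteq> carrier E"
    using observable_closed V_borel by blast
  ultimately have "x (\<Union>n. V n) \<in> carrier E" "ele E (x (\<Union>n. V n)) (ezero E)"
    using least_Upper_eorder_iff V_null ezero_closed ele_refl by auto
  then have "x (\<Union>n. V n) = ezero E"
    by (rule ele_ezero_imp_eq)
  moreover have "(\<Union>n. V n) = (\<Union>i. U i)"
    unfolding V_def by blast
  ultimately show ?thesis by simp
qed

text \<open>
  The union of all open null sets is null, because by the Lindelof property countably many of them
  already cover it. Its complement is then the least closed set of value \<open>1\<close>.
\<close>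

lemma spectrum_carries_observable:
  "closed (spectrum E x)" "x (spectrum E x) = eunit E"
proof -
  define N where "N = {U. open U \<and> x U = ezero E}"
  obtain F where F: "F \<subseteq> N" "countable F" "\<Union>F = \<Union>N"
    using Lindelof[of N] unfolding N_def by blast
  \<comment> \<open>Adding the empty set, which is null, makes the family nonempty, so that a sequence runs
    through it.\<close>
  let ?U = "from_nat_into (insert {} F)"
  have rangeU: "range ?U = insert {} F"
    using F(2) by simp
  have "insert {} F \<subseteq> N"
    using F(1) observable_empty by (simp add: N_def)
  then have "?U i \<in> N" for i
    using rangeU by (metis rangeI subsetD)
  then have "x (\<Union>i. ?U i) = ezero E"
    by (intro observable_null_UN) (auto simp: N_def)
  moreover have "(\<Union>i. ?U i) = \<Union>N"
    using rangeU F(3) by simp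
  ultimately have null: "x (\<Union>N) = ezero E"
    by simp
  have op: "open (\<Union>N)"
    unfolding N_def by blast
  then have cl: "closed (- \<Union>N)"
    by (simp add: closed_def)
  have carries: "x (- \<Union>N) = eunit E"
    using observable_eq_eunit_iff[OF borel_closed[OF cl]] null by simp
  have least: "- \<Union>N \<subseteq> K" if "closed K" "x K = eunit E" for K
  proof -
    have "- K \<in> N"
      using that observable_eq_eunit_iff[OF borel_closed[OF that(1)]] unfolding N_def by auto
    then show ?thesis by blast
  qed
  have "spectrum E x = - \<Union>N"
    unfolding spectrum_def
  proof (rule Least_equality)
    show "closed (- \<Union>N) \<and> x (- \<Union>N) = eunit E"
      using cl carries by blast
    show "- \<Union>N \<subseteq> K" if "closed K \<and> x K = eunit E" for K
      using least that by blast
  qed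
  then show "closed (spectrum E x)" "x (spectrum E x) = eunit E"
    using cl carries by simp_all
qed

lemma observable_eq_eunit_of_spectrum_subset:
  assumes "B \<in> sets borel" "spectrum E x \<subseteq> B"
  shows "x B = eunit E"
  using observable_mono[OF borel_closed[OF spectrum_carries_observable(1)] assms]
    spectrum_carries_observable(2) eunit_ele_imp_eq by simp

lemma observable_eq_ezero_of_disjoint_spectrum:
  assumes "B \<in> sets borel" "spectrum E x \<inter> B = {}"
  shows "x B = ezero E"
proof -
  have B': "- B \<in> sets borel"
    using assms(1) by (simp add: borel_comp)
  have "x (- B) = eunit E"
    using assms(2) by (intro observable_eq_eunit_of_spectrum_subset[OF B']) blast
  then show ?thesis
    using observable_eq_eunit_iff[OF B'] by simp
qed

end

section \<open>The extreme question observables\<close>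

lemma question_ezero_olson_le:
  assumes "x \<in> EO E"
  shows "olson_le E (question E (ezero E)) x"
proof -
  have x: "observable E x" and spec: "spectrum E x \<subseteq> {0..1}"
    using assms unfolding EO_def by auto
  have "ele E (x {..<t}) (question E (ezero E) {..<t})" for t
  proof (cases "t \<le> 0")
    case True
    then have "spectrum E x \<inter> {..<t} = {}"
      using spec by fastforce
    then have "x {..<t} = ezero E"
      by (intro observable_eq_ezero_of_disjoint_spectrum[OF x]) auto
    then show ?thesis
      using ezero_ele question_closed ezero_closed by simp
  next
    case False
    then show ?thesis
      using ele_eunit observable_closed[OF x] by (simp add: question_lessThan ecompl_ezero)
  qed
  then show ?thesis
    unfolding olson_le_def using x observable_question[OF ezero_closed] by blast
qed

lemma olson_le_question_eunit:
  assumes "x \<in> EO E"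
  shows "olson_le E x (question E (eunit E))"
proof -
  have x: "observable E x" and spec: "spectrum E x \<subseteq> {0..1}"
    using assms unfolding EO_def by auto
  have "ele E (question E (eunit E) {..<t}) (x {..<t})" for t
  proof (cases "t \<le> 1")
    case True
    then show ?thesis
      using ezero_ele observable_closed[OF x] by (simp add: question_lessThan ecompl_eunit)
  next
    case False
    then have "spectrum E x \<subseteq> {..<t}"
      using spec by fastforce
    then have "x {..<t} = eunit E"
      by (intro observable_eq_eunit_of_spectrum_subset[OF x]) auto
    then show ?thesis
      using ele_eunit question_closed eunit_closed by simp
  qed
  then show ?thesis
    unfolding olson_le_def using x observable_question[OF eunit_closed] by blast
qed

end

theorem proposition3p2:
  fixes E :: "('a, 'm) effect_structure_scheme" and a b :: 'a
  assumes "sigma_lattice_effect_algebra E"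
    and "a \<in> carrier E" and "b \<in> carrier E"
  shows "(olson_le E (question E a) (question E b) \<longleftrightarrow> ele E a b) \<and>
    (\<forall>x\<in>EO E. olson_le E (question E (ezero E)) x \<and> olson_le E x (question E (eunit E)))"
proof -
  interpret sigma_lattice_effect_algebra E
    by (rule assms(1))
  show ?thesis
    using olson_le_question_iff[OF assms(2,3)] question_ezero_olson_le olson_le_question_eunit
    by blast
qed

end
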